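(* Let $A$ be a commutative $\Bbbk$-algebra and $(A,L,\omega)$ a Lie-Rinehart algebra. For a left $A$-module $M$, the datum of a left $(A,L,\omega)$-module structure on $M$ is equivalent to the datum of a morphism $L\to\mathcal{L}_A(\mathrm{End}_\Bbbk(M))$ of Lie-Rinehart algebras over $A$.
   Context: $\Bbbk$ is a field of characteristic $0$. A Lie-Rinehart algebra $(A,L,\omega)$ over a commutative $\Bbbk$-algebra $A$ is a $\Bbbk$-Lie algebra $L$ with a left $A$-module structure and a Lie algebra morphism $\omega:L\to\mathrm{Der}_\Bbbk(A)$ (the anchor) such that $\omega(a\cdot X)=a\cdot\omega(X)$ and $[X,a\cdot Y]=a\cdot[X,Y]+\omega(X)(a)\cdot Y$ for all $a\in A$, $X,Y\in L$. A morphism over $A$ from $(L,\omega)$ to $(L',\omega')$ is an $A$-linear Lie algebra morphism $f$ with $\omega'\circ f=\omega$. A left $(A,L,\omega)$-module structure (in the sense of Huebschmann) on the left $A$-module $M$ is a Lie algebra morphism $\rho:L\to\mathrm{End}_\Bbbk(M)$ (commutator bracket) such that $\rho(a\cdot X)(m)=a\cdot\rho(X)(m)$ and $\rho(X)(a\cdot m)=a\cdot\rho(X)(m)+\omega(X)(a)\cdot m$ for all $X\in L$, $m\in M$, $a\in A$. For a $\Bbbk$-algebra $R$ with a $\Bbbk$-algebra map $\phi:A\to R$, $\mathcal{L}_A(R)=\{(r,\delta)\in R\times\mathrm{Der}_\Bbbk(A)\mid[r,\phi(a)]=\phi(\delta(a))\ \forall a\in A\}$, a Lie-Rinehart algebra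 over $A$ with component-wise bracket, action $a\cdot(r,\delta)=(\phi(a)r,a\cdot\delta)$ and anchor $(r,\delta)\mapsto\delta$. Here $R=\mathrm{End}_\Bbbk(M)$ with $\phi(a)=l_a$, $l_a(m)=a\cdot m$. *)

theory Defs
  imports "HOL-Algebra.Module" "HOL-Library.FuncSet"
begin

definition char_zero :: "('k, 'x) ring_scheme \<Rightarrow> bool" where
  "char_zero K \<longleftrightarrow> (\<forall>n::nat. 0 < n \<longrightarrow> [n] \<cdot>\<^bsub>K\<^esub> \<one>\<^bsub>K\<^esub> \<noteq> \<zero>\<^bsub>K\<^esub>)"


section \<open>Lie algebras\<close>

text \<open>The record of modules in the library extends that of rings, so modules carry fields
  \<open>mult\<close> and \<open>one\<close> that have no meaning; the Lie bracket is a separate field.\<close>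

record ('k, 'l) lie_algebra = "('k, 'l) module" +
  bracket :: "'l \<Rightarrow> 'l \<Rightarrow> 'l"

locale lie_algebra = module K L for K (structure) and L (structure) +
  assumes bracket_closed:
      "\<lbrakk>x \<in> carrier L; y \<in> carrier L\<rbrakk> \<Longrightarrow> bracket L x y \<in> carrier L"
    and bracket_add_left:
      "\<lbrakk>x \<in> carrier L; y \<in> carrier L; z \<in> carrier L\<rbrakk> \<Longrightarrow>
        bracket L (x \<oplus>\<^bsub>L\<^esub> y) z = bracket L x z \<oplus>\<^bsub>L\<^esub> bracket L y z"
    and bracket_add_right:
      "\<lbrakk>x \<in> carrier L; y \<in> carrier L; z \<in> carrier L\<rbrakk> \<Longrightarrow>
        bracket L x (y \<oplus>\<^bsub>L\<^esub> z) = bracket L x y \<oplus>\<^bsub>L\<^esub> bracket L x z"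
    and bracket_smult_left:
      "\<lbrakk>c \<in> carrier K; x \<in> carrier L; y \<in> carrier L\<rbrakk> \<Longrightarrow>
        bracket L (c \<odot>\<^bsub>L\<^esub> x) y = c \<odot>\<^bsub>L\<^esub> bracket L x y"
    and bracket_smult_right:
      "\<lbrakk>c \<in> carrier K; x \<in> carrier L; y \<in> carrier L\<rbrakk> \<Longrightarrow>
        bracket L x (c \<odot>\<^bsub>L\<^esub> y) = c \<odot>\<^bsub>L\<^esub> bracket L x y"
    and bracket_self: "x \<in> carrier L \<Longrightarrow> bracket L x x = \<zero>\<^bsub>L\<^esub>"
    and jacobi:
      "\<lbrakk>x \<in> carrier L; y \<in> carrier L; z \<in> carrier L\<rbrakk> \<Longrightarrow>
        bracket L x (bracket L y z) \<oplus>\<^bsub>L\<^esub> bracket L y (bracket L z x)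
          \<oplus>\<^bsub>L\<^esub> bracket L z (bracket L x y) = \<zero>\<^bsub>L\<^esub>"

definition linear_maps ::
    "('k, 'x) ring_scheme \<Rightarrow> ('k, 'v, 'y) module_scheme \<Rightarrow> ('k, 'w, 'z) module_scheme
      \<Rightarrow> ('v \<Rightarrow> 'w) set" where
  "linear_maps K V W = {f \<in> carrier V \<rightarrow> carrier W.
     (\<forall>v\<in>carrier V. \<forall>v'\<in>carrier V. f (v \<oplus>\<^bsub>V\<^esub> v') = f v \<oplus>\<^bsub>W\<^esub> f v') \<and>
     (\<forall>c\<in>carrier K. \<forall>v\<in>carrier V. f (c \<odot>\<^bsub>V\<^esub> v) = c \<odot>\<^bsub>W\<^esub> f v)}"

definition lie_hom ::
    "('k, 'x) ring_scheme \<Rightarrow> ('k, 'l, 'y) lie_algebra_scheme \<Rightarrow> ('k, 'm, 'z) lie_algebra_scheme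
      \<Rightarrow> ('l \<Rightarrow> 'm) set" where
  "lie_hom K L L' = {f \<in> linear_maps K L L'.
     \<forall>x\<in>carrier L. \<forall>y\<in>carrier L. f (bracket L x y) = bracket L' (f x) (f y)}"


section \<open>Endomorphisms and derivations\<close>

text \<open>Endomorphisms and derivations are represented by functions that are \<open>undefined\<close>
  outside the carrier, so that equality of functions is equality of maps.\<close>

definition End_algebra ::
    "('k, 'x) ring_scheme \<Rightarrow> ('k, 'v, 'y) module_scheme \<Rightarrow> ('k, 'v \<Rightarrow> 'v) module" where
  "End_algebra K V =
    \<lparr>carrier = linear_maps K V V \<inter> extensional (carrier V),
     mult = compose (carrier V),
     one = (\<lambda>v\<in>carrier V. v),
     zero = (\<lambda>v\<in>carrier V. \<zero>\<^bsub>V\<^esub>),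
     add = (\<lambda>f g. \<lambda>v\<in>carrier V. f v \<oplus>\<^bsub>V\<^esub> g v),
     smult = (\<lambda>c f. \<lambda>v\<in>carrier V. c \<odot>\<^bsub>V\<^esub> f v)\<rparr>"

definition commutator :: "('r, 'x) ring_scheme \<Rightarrow> 'r \<Rightarrow> 'r \<Rightarrow> 'r" where
  "commutator R r s = r \<otimes>\<^bsub>R\<^esub> s \<ominus>\<^bsub>R\<^esub> s \<otimes>\<^bsub>R\<^esub> r"

definition commutator_lie :: "('k, 'r, 'x) module_scheme \<Rightarrow> ('k, 'r) lie_algebra" where
  "commutator_lie R =
    \<lparr>carrier = carrier R, mult = mult R, one = one R, zero = zero R, add = add R,
     smult = smult R, bracket = commutator R\<rparr>"

definition derivations ::
    "('k, 'x) ring_scheme \<Rightarrow> ('k, 'a, 'y) module_scheme \<Rightarrow> ('a \<Rightarrow> 'a) set" where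
  "derivations K A = {\<delta> \<in> carrier (End_algebra K A).
     \<forall>a\<in>carrier A. \<forall>b\<in>carrier A. \<delta> (a \<otimes>\<^bsub>A\<^esub> b) = a \<otimes>\<^bsub>A\<^esub> \<delta> b \<oplus>\<^bsub>A\<^esub> \<delta> a \<otimes>\<^bsub>A\<^esub> b}"

definition Der ::
    "('k, 'x) ring_scheme \<Rightarrow> ('k, 'a, 'y) module_scheme \<Rightarrow> ('k, 'a \<Rightarrow> 'a) lie_algebra" where
  "Der K A = (commutator_lie (End_algebra K A))\<lparr>carrier := derivations K A\<rparr>"

definition der_scale ::
    "('k, 'a, 'y) module_scheme \<Rightarrow> 'a \<Rightarrow> ('a \<Rightarrow> 'a) \<Rightarrow> 'a \<Rightarrow> 'a" where
  "der_scale A a \<delta> = (\<lambda>b\<in>carrier A. a \<otimes>\<^bsub>A\<^esub> \<delta> b)"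


section \<open>Lie-Rinehart algebras\<close>

text \<open>The field \<open>smult\<close> is the action of the ground field and \<open>act\<close> that of \<open>A\<close>.\<close>

record ('k, 'a, 'l) lie_rinehart = "('k, 'l) lie_algebra" +
  act :: "'a \<Rightarrow> 'l \<Rightarrow> 'l"
  anchor :: "'l \<Rightarrow> 'a \<Rightarrow> 'a"

definition act_module :: "('k, 'a, 'l, 'x) lie_rinehart_scheme \<Rightarrow> ('a, 'l) module" where
  "act_module L =
    \<lparr>carrier = carrier L, mult = mult L, one = one L, zero = zero L, add = add L,
     smult = act L\<rparr>"

text \<open>The assumption \<open>act_scalar\<close> is the usual convention that the two actions of the ground
  field on \<open>L\<close>, directly and through \<open>A\<close>, agree.\<close>

locale lie_rinehart =
  A: algebra K A + L: lie_algebra K L + AL: module A "act_module L"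
  for K (structure) and A (structure) and L (structure) +
  assumes act_scalar:
      "\<lbrakk>c \<in> carrier K; X \<in> carrier L\<rbrakk> \<Longrightarrow> act L (c \<odot>\<^bsub>A\<^esub> \<one>\<^bsub>A\<^esub>) X = c \<odot>\<^bsub>L\<^esub> X"
    and anchor_lie_hom: "anchor L \<in> lie_hom K L (Der K A)"
    and anchor_act:
      "\<lbrakk>a \<in> carrier A; X \<in> carrier L\<rbrakk> \<Longrightarrow>
        anchor L (act L a X) = der_scale A a (anchor L X)"
    and bracket_act:
      "\<lbrakk>a \<in> carrier A; X \<in> carrier L; Y \<in> carrier L\<rbrakk> \<Longrightarrow>
        bracket L X (act L a Y) = act L a (bracket L X Y) \<oplus>\<^bsub>L\<^esub> act L (anchor L X a) Y"

definition lie_rinehart_morphism ::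
    "('k, 'x) ring_scheme \<Rightarrow> ('k, 'a, 'y) module_scheme \<Rightarrow> ('k, 'a, 'l, 'z) lie_rinehart_scheme
      \<Rightarrow> ('k, 'a, 'm, 'w) lie_rinehart_scheme \<Rightarrow> ('l \<Rightarrow> 'm) \<Rightarrow> bool" where
  "lie_rinehart_morphism K A L L' f \<longleftrightarrow>
     lie_rinehart K A L \<and> lie_rinehart K A L' \<and>
     f \<in> lie_hom K L L' \<and>
     (\<forall>a\<in>carrier A. \<forall>X\<in>carrier L. f (act L a X) = act L' a (f X)) \<and>
     (\<forall>X\<in>carrier L. anchor L' (f X) = anchor L X)"


section \<open>The Lie-Rinehart algebra of an algebra under \<open>A\<close>\<close>

text \<open>Here \<open>R\<close> is a \<open>K\<close>-algebra with an algebra map \<open>\<phi>\<close> from \<open>A\<close>.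
  The fields \<open>mult\<close> and \<open>one\<close> have no meaning.\<close>

definition LR_of ::
    "('k, 'x) ring_scheme \<Rightarrow> ('k, 'a, 'y) module_scheme \<Rightarrow> ('k, 'r, 'z) module_scheme
      \<Rightarrow> ('a \<Rightarrow> 'r) \<Rightarrow> ('k, 'a, 'r \<times> ('a \<Rightarrow> 'a)) lie_rinehart" where
  "LR_of K A R \<phi> =
    \<lparr>carrier = {(r, \<delta>). r \<in> carrier R \<and> \<delta> \<in> derivations K A \<and>
                 (\<forall>a\<in>carrier A. commutator R r (\<phi> a) = \<phi> (\<delta> a))},
     mult = undefined,
     one = undefined,
     zero = (\<zero>\<^bsub>R\<^esub>, \<zero>\<^bsub>Der K A\<^esub>),
     add = (\<lambda>(r, \<delta>) (s, \<epsilon>). (r \<oplus>\<^bsub>R\<^esub> s, \<delta> \<oplus>\<^bsub>Der K A\<^esub> \<epsilon>)),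
     smult = (\<lambda>c (r, \<delta>). (c \<odot>\<^bsub>R\<^esub> r, c \<odot>\<^bsub>Der K A\<^esub> \<delta>)),
     bracket = (\<lambda>(r, \<delta>) (s, \<epsilon>). (commutator R r s, bracket (Der K A) \<delta> \<epsilon>)),
     act = (\<lambda>a (r, \<delta>). (\<phi> a \<otimes>\<^bsub>R\<^esub> r, der_scale A a \<delta>)),
     anchor = snd\<rparr>"


section \<open>Modules over Lie-Rinehart algebras\<close>

text \<open>An \<open>A\<close>-module is a module over the ground field through \<open>A\<close>.\<close>

definition restrict_scalars ::
    "('k, 'a, 'y) module_scheme \<Rightarrow> ('a, 'm, 'z) module_scheme \<Rightarrow> ('k, 'm) module" where
  "restrict_scalars A M =
    \<lparr>carrier = carrier M, mult = mult M, one = one M, zero = zero M, add = add M,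
     smult = (\<lambda>c m. (c \<odot>\<^bsub>A\<^esub> \<one>\<^bsub>A\<^esub>) \<odot>\<^bsub>M\<^esub> m)\<rparr>"

definition End_module ::
    "('k, 'x) ring_scheme \<Rightarrow> ('k, 'a, 'y) module_scheme \<Rightarrow> ('a, 'm, 'z) module_scheme
      \<Rightarrow> ('k, 'm \<Rightarrow> 'm) module" where
  "End_module K A M = End_algebra K (restrict_scalars A M)"

definition left_mult :: "('a, 'm, 'z) module_scheme \<Rightarrow> 'a \<Rightarrow> 'm \<Rightarrow> 'm" where
  "left_mult M a = (\<lambda>m\<in>carrier M. a \<odot>\<^bsub>M\<^esub> m)"

definition lie_rinehart_module ::
    "('k, 'x) ring_scheme \<Rightarrow> ('k, 'a, 'y) module_scheme \<Rightarrow> ('k, 'a, 'l, 'z) lie_rinehart_scheme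
      \<Rightarrow> ('a, 'm, 'w) module_scheme \<Rightarrow> ('l \<Rightarrow> 'm \<Rightarrow> 'm) \<Rightarrow> bool" where
  "lie_rinehart_module K A L M \<rho> \<longleftrightarrow>
     \<rho> \<in> lie_hom K L (commutator_lie (End_module K A M)) \<and>
     (\<forall>a\<in>carrier A. \<forall>X\<in>carrier L. \<forall>m\<in>carrier M.
        \<rho> (act L a X) m = a \<odot>\<^bsub>M\<^esub> \<rho> X m) \<and>
     (\<forall>X\<in>carrier L. \<forall>m\<in>carrier M. \<forall>a\<in>carrier A.
        \<rho> X (a \<odot>\<^bsub>M\<^esub> m) = a \<odot>\<^bsub>M\<^esub> \<rho> X m \<oplus>\<^bsub>M\<^esub> anchor L X a \<odot>\<^bsub>M\<^esub> m)"

end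

theory Submission
  imports Defs "HOL-Algebra.RingHom"
begin

text \<open>For an algebra \<open>R\<close> under \<open>A\<close> via \<open>\<phi>\<close>, say that \<open>r\<close> lies over \<open>\<delta>\<close> if
  \<open>[r, \<phi> a] = \<phi> (\<delta> a)\<close> for all \<open>a\<close>. The Leibniz rule for \<open>\<rho> X\<close> says exactly that \<open>\<rho> X\<close> lies
  over the anchor of \<open>X\<close>, so \<open>\<rho>\<close> and \<open>X \<mapsto> (\<rho> X, \<omega> X)\<close> determine each other. That the target is a
  Lie-Rinehart algebra follows from the same closure properties used twice: \<open>\<delta>\<close> is a derivation
  of \<open>A\<close> iff it lies over itself, for the regular representation of \<open>A\<close> in its endomorphisms.
  Both components of a pair thus live in algebras under \<open>A\<close>, where scaling by \<open>a\<close> is left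
  multiplication by the image of \<open>a\<close>.\<close>

section \<open>Commutators\<close>

text \<open>The locale \<open>algebra\<close> demands a commutative multiplication, which
  endomorphisms do not have. Without commutativity neither of the two rules for moving a scalar out
  of a product gives the other, so both are assumed.\<close>

locale assoc_algebra = ring R + module K R for K (structure) and R (structure) +
  assumes smult_mult_left:
      "\<lbrakk>c \<in> carrier K; r \<in> carrier R; s \<in> carrier R\<rbrakk> \<Longrightarrow>
        (c \<odot>\<^bsub>R\<^esub> r) \<otimes>\<^bsub>R\<^esub> s = c \<odot>\<^bsub>R\<^esub> (r \<otimes>\<^bsub>R\<^esub> s)"
    and smult_mult_right:
      "\<lbrakk>c \<in> carrier K; r \<in> carrier R; s \<in> carrier R\<rbrakk> \<Longrightarrow>
        r \<otimes>\<^bsub>R\<^esub> (c \<odot>\<^bsub>R\<^esub> s) = c \<odot>\<^bsub>R\<^esub> (r \<otimes>\<^bsub>R\<^esub> s)"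

context ring
begin

lemma commutator_closed [simp]:
  "\<lbrakk>r \<in> carrier R; s \<in> carrier R\<rbrakk> \<Longrightarrow> commutator R r s \<in> carrier R"
  by (simp add: commutator_def)

lemma commutator_add_left:
  "\<lbrakk>r \<in> carrier R; s \<in> carrier R; t \<in> carrier R\<rbrakk> \<Longrightarrow>
    commutator R (r \<oplus> s) t = commutator R r t \<oplus> commutator R s t"
  unfolding commutator_def by algebra

lemma commutator_add_right:
  "\<lbrakk>r \<in> carrier R; s \<in> carrier R; t \<in> carrier R\<rbrakk> \<Longrightarrow>
    commutator R r (s \<oplus> t) = commutator R r s \<oplus> commutator R r t"
  unfolding commutator_def by algebra

lemma commutator_self: "r \<in> carrier R \<Longrightarrow> commutator R r r = \<zero>"
  unfolding commutator_def by algebra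

lemma commutator_zero_left: "r \<in> carrier R \<Longrightarrow> commutator R \<zero> r = \<zero>"
  unfolding commutator_def by algebra

lemma commutator_jacobi:
  "\<lbrakk>r \<in> carrier R; s \<in> carrier R; t \<in> carrier R\<rbrakk> \<Longrightarrow>
    commutator R r (commutator R s t) \<oplus> commutator R s (commutator R t r)
      \<oplus> commutator R t (commutator R r s) = \<zero>"
  unfolding commutator_def by algebra

text \<open>The Jacobi identity in the form ad [r, s] = [ad r, ad s]. In this form it shows that
  lying over a map is compatible with brackets.\<close>

lemma commutator_commutator_left:
  "\<lbrakk>r \<in> carrier R; s \<in> carrier R; t \<in> carrier R\<rbrakk> \<Longrightarrow>
    commutator R (commutator R r s) t
      = commutator R r (commutator R s t) \<ominus> commutator R s (commutator R r t)"
  unfolding commutator_def by algebra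

text \<open>Bracketing with a fixed element is a derivation of the ring. This rule serves
  \<open>lies_over_scale\<close>; its counterpart in the other argument gives the Leibniz rule for
  the action of \<open>A\<close>.\<close>

lemma commutator_mult_left:
  "\<lbrakk>r \<in> carrier R; s \<in> carrier R; t \<in> carrier R\<rbrakk> \<Longrightarrow>
    commutator R (r \<otimes> s) t = r \<otimes> commutator R s t \<oplus> commutator R r t \<otimes> s"
  unfolding commutator_def by algebra

lemma commutator_mult_right:
  "\<lbrakk>r \<in> carrier R; s \<in> carrier R; t \<in> carrier R\<rbrakk> \<Longrightarrow>
    commutator R r (s \<otimes> t) = s \<otimes> commutator R r t \<oplus> commutator R r s \<otimes> t"
  unfolding commutator_def by algebra

end

context assoc_algebra
begin

lemma smult_minus_distr:
  "\<lbrakk>c \<in> carrier K; r \<in> carrier R; s \<in> carrier R\<rbrakk> \<Longrightarrow>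
    c \<odot>\<^bsub>R\<^esub> (r \<ominus>\<^bsub>R\<^esub> s) = c \<odot>\<^bsub>R\<^esub> r \<ominus>\<^bsub>R\<^esub> c \<odot>\<^bsub>R\<^esub> s"
  by (simp add: a_minus_def smult_r_distr smult_r_minus)

lemma commutator_smult_left:
  "\<lbrakk>c \<in> carrier K; r \<in> carrier R; s \<in> carrier R\<rbrakk> \<Longrightarrow>
    commutator R (c \<odot>\<^bsub>R\<^esub> r) s = c \<odot>\<^bsub>R\<^esub> commutator R r s"
  by (simp add: commutator_def smult_mult_left smult_mult_right smult_minus_distr)

lemma commutator_smult_right:
  "\<lbrakk>c \<in> carrier K; r \<in> carrier R; s \<in> carrier R\<rbrakk> \<Longrightarrow>
    commutator R r (c \<odot>\<^bsub>R\<^esub> s) = c \<odot>\<^bsub>R\<^esub> commutator R r s"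
  by (simp add: commutator_def smult_mult_left smult_mult_right smult_minus_distr)

end


section \<open>Endomorphism algebras\<close>

text \<open>Unfolding to functions is the default only while the ring and module laws are being
  checked. Afterwards the operations stay folded, so that abstract laws of rings and modules apply
  to them.\<close>

lemma End_algebra_simps [simp]:
  "mult (End_algebra K V) = compose (carrier V)"
  "one (End_algebra K V) = (\<lambda>v\<in>carrier V. v)"
  "zero (End_algebra K V) = (\<lambda>v\<in>carrier V. \<zero>\<^bsub>V\<^esub>)"
  "add (End_algebra K V) = (\<lambda>f g. \<lambda>v\<in>carrier V. f v \<oplus>\<^bsub>V\<^esub> g v)"
  "smult (End_algebra K V) = (\<lambda>c f. \<lambda>v\<in>carrier V. c \<odot>\<^bsub>V\<^esub> f v)"
  by (simp_all add: End_algebra_def)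

lemma End_algebra_memI:
  assumes "\<And>v. v \<in> carrier V \<Longrightarrow> f v \<in> carrier V"
    and "\<And>v w. \<lbrakk>v \<in> carrier V; w \<in> carrier V\<rbrakk> \<Longrightarrow> f (v \<oplus>\<^bsub>V\<^esub> w) = f v \<oplus>\<^bsub>V\<^esub> f w"
    and "\<And>c v. \<lbrakk>c \<in> carrier K; v \<in> carrier V\<rbrakk> \<Longrightarrow> f (c \<odot>\<^bsub>V\<^esub> v) = c \<odot>\<^bsub>V\<^esub> f v"
    and "f \<in> extensional (carrier V)"
  shows "f \<in> carrier (End_algebra K V)"
  using assms by (auto simp: End_algebra_def linear_maps_def)

lemma End_algebra_memD:
  assumes "f \<in> carrier (End_algebra K V)"
  shows "v \<in> carrier V \<Longrightarrow> f v \<in> carrier V"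
    and "\<lbrakk>v \<in> carrier V; w \<in> carrier V\<rbrakk> \<Longrightarrow> f (v \<oplus>\<^bsub>V\<^esub> w) = f v \<oplus>\<^bsub>V\<^esub> f w"
    and "\<lbrakk>c \<in> carrier K; v \<in> carrier V\<rbrakk> \<Longrightarrow> f (c \<odot>\<^bsub>V\<^esub> v) = c \<odot>\<^bsub>V\<^esub> f v"
    and "f \<in> extensional (carrier V)"
  using assms by (auto simp: End_algebra_def linear_maps_def)

lemma End_algebra_eqI:
  assumes "f \<in> carrier (End_algebra K V)" "g \<in> carrier (End_algebra K V)"
    and "\<And>v. v \<in> carrier V \<Longrightarrow> f v = g v"
  shows "f = g"
  using assms by (blast intro: extensionalityI End_algebra_memD)

section \<open>Ring, module and algebra structure on the endomorphisms of a module\<close>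

context module
begin

lemma End_algebra_add_closed:
  assumes "f \<in> carrier (End_algebra R M)" "g \<in> carrier (End_algebra R M)"
  shows "f \<oplus>\<^bsub>End_algebra R M\<^esub> g \<in> carrier (End_algebra R M)"
  by (rule End_algebra_memI)
    (use assms in \<open>simp_all add: End_algebra_memD[OF assms(1)] End_algebra_memD[OF assms(2)]
      M.a_ac smult_r_distr\<close>)

lemma End_algebra_mult_closed:
  assumes "f \<in> carrier (End_algebra R M)" "g \<in> carrier (End_algebra R M)"
  shows "f \<otimes>\<^bsub>End_algebra R M\<^esub> g \<in> carrier (End_algebra R M)"
  by (rule End_algebra_memI)
    (simp_all add: End_algebra_memD[OF assms(1)] End_algebra_memD[OF assms(2)] compose_def)

lemma End_algebra_smult_closed:
  assumes "c \<in> carrier R" "f \<in> carrier (End_algebra R M)"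
  shows "c \<odot>\<^bsub>End_algebra R M\<^esub> f \<in> carrier (End_algebra R M)"
  by (rule End_algebra_memI)
    (simp_all add: assms(1) End_algebra_memD[OF assms(2)] smult_r_distr R.m_comm
      flip: smult_assoc1)

lemma End_algebra_zero_closed: "\<zero>\<^bsub>End_algebra R M\<^esub> \<in> carrier (End_algebra R M)"
  by (rule End_algebra_memI) simp_all

lemma End_algebra_one_closed: "\<one>\<^bsub>End_algebra R M\<^esub> \<in> carrier (End_algebra R M)"
  by (rule End_algebra_memI) simp_all

lemmas End_algebra_closed = End_algebra_add_closed End_algebra_mult_closed
  End_algebra_smult_closed End_algebra_zero_closed End_algebra_one_closed

lemma End_algebra_abelian_group: "abelian_group (End_algebra R M)"
proof (rule abelian_groupI)
  fix f assume f: "f \<in> carrier (End_algebra R M)"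
  \<comment> \<open>Taking (-1) f as the negative of f makes its linearity an instance of closure
    under scalars.\<close>
  have "(\<ominus> \<one>) \<odot>\<^bsub>End_algebra R M\<^esub> f \<oplus>\<^bsub>End_algebra R M\<^esub> f = \<zero>\<^bsub>End_algebra R M\<^esub>"
    by (auto simp: End_algebra_memD(1)[OF f] smult_l_minus M.l_neg restrict_def)
  then show "\<exists>g\<in>carrier (End_algebra R M). g \<oplus>\<^bsub>End_algebra R M\<^esub> f = \<zero>\<^bsub>End_algebra R M\<^esub>"
    using f by (blast intro: End_algebra_smult_closed R.a_inv_closed R.one_closed)
\<comment> \<open>The laws are compared at every argument. Outside the carrier a restricted function
  is \<open>undefined\<close>, and so is f by extensionality.\<close>
qed (blast intro: End_algebra_closed | rule ext,
     auto simp: End_algebra_memD(1) M.a_ac restrict_def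
       intro: extensional_arb[OF End_algebra_memD(4), symmetric])+

lemma End_algebra_ring: "ring (End_algebra R M)"
proof (rule ringI[OF End_algebra_abelian_group])
  show "monoid (End_algebra R M)"
    by (rule monoidI)
      (blast intro: End_algebra_closed | rule ext,
       auto simp: End_algebra_memD(1) compose_def restrict_def
         intro: extensional_arb[OF End_algebra_memD(4), symmetric])+
qed (rule ext, auto simp: End_algebra_memD(1,2) compose_def restrict_def)+

lemma End_algebra_module: "module R (End_algebra R M)"
  by (rule moduleI[OF R.is_cring End_algebra_abelian_group])
    (blast intro: End_algebra_closed | rule ext,
     auto simp: End_algebra_memD(1) smult_l_distr smult_r_distr smult_assoc1 restrict_def
       intro: extensional_arb[OF End_algebra_memD(4), symmetric])+

lemma End_algebra_assoc_algebra: "assoc_algebra R (End_algebra R M)"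
  by (rule assoc_algebra.intro[OF End_algebra_ring End_algebra_module], unfold_locales)
    (rule ext, auto simp: End_algebra_memD(1,3) compose_def restrict_def)+

lemma End_algebra_commutator_apply:
  assumes f: "f \<in> carrier (End_algebra R M)" and g: "g \<in> carrier (End_algebra R M)"
    and x: "x \<in> carrier M"
  shows "commutator (End_algebra R M) f g x = f (g x) \<ominus>\<^bsub>M\<^esub> g (f x)"
proof -
  interpret E: ring "End_algebra R M"
    by (rule End_algebra_ring)
  define h where "h = commutator (End_algebra R M) f g"
  have h: "h \<in> carrier (End_algebra R M)"
    using f g by (simp add: h_def)
  \<comment> \<open>The negative in the endomorphism ring is known only as an abstract inverse, not
    by a formula at each point. Adding g f back leaves only sums and products, which can be
    evaluated at x.\<close>
  have "h \<oplus>\<^bsub>End_algebra R M\<^esub> g \<otimes>\<^bsub>End_algebra R M\<^esub> f = f \<otimes>\<^bsub>End_algebra R M\<^esub> g"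
    unfolding h_def commutator_def using f g
    by (simp add: E.a_assoc E.minus_eq E.l_neg del: End_algebra_simps)
  then have "h x \<oplus>\<^bsub>M\<^esub> g (f x) = f (g x)"
    using x by (auto simp: compose_def dest: fun_cong[of _ _ x])
  then show ?thesis
    unfolding h_def[symmetric]
    using f g h x by (metis End_algebra_memD(1) M.add.inv_solve_right a_minus_def)
qed

end

declare End_algebra_simps [simp del]


section \<open>Algebras under a commutative algebra\<close>

locale algebra_under = A: algebra K A + assoc_algebra K R
  for K (structure) and A (structure) and R (structure) +
  fixes \<phi>
  assumes hom: "\<phi> \<in> ring_hom A R"
    and hom_smult:
      "\<lbrakk>c \<in> carrier K; a \<in> carrier A\<rbrakk> \<Longrightarrow> \<phi> (c \<odot>\<^bsub>A\<^esub> a) = c \<odot>\<^bsub>R\<^esub> \<phi> a"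

text \<open>Nothing is asked of \<open>\<delta>\<close>, not even linearity, so that the relation
  can express the derivation property itself.\<close>

definition lies_over ::
    "('a, 'y) ring_scheme \<Rightarrow> ('r, 'z) ring_scheme \<Rightarrow> ('a \<Rightarrow> 'r) \<Rightarrow> 'r \<Rightarrow> ('a \<Rightarrow> 'a) \<Rightarrow> bool" where
  "lies_over A R \<phi> r \<delta> \<longleftrightarrow> r \<in> carrier R \<and> (\<forall>a\<in>carrier A. commutator R r (\<phi> a) = \<phi> (\<delta> a))"

lemma lies_over_carrier: "lies_over A R \<phi> r \<delta> \<Longrightarrow> r \<in> carrier R"
  by (simp add: lies_over_def)

section \<open>The regular representation and derivations\<close>

definition regular :: "('a, 'y) ring_scheme \<Rightarrow> 'a \<Rightarrow> 'a \<Rightarrow> 'a" where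
  "regular A a = (\<lambda>b\<in>carrier A. a \<otimes>\<^bsub>A\<^esub> b)"

lemma (in algebra) regular_closed:
  "a \<in> carrier M \<Longrightarrow> regular M a \<in> carrier (End_algebra R M)"
  by (rule End_algebra_memI)
    (simp_all add: regular_def r_distr m_comm[of a] smult_assoc2)

lemma (in algebra) regular_algebra_under:
  "algebra_under R M (End_algebra R M) (regular M)"
proof (intro algebra_under.intro End_algebra_assoc_algebra algebra_under_axioms.intro ring_hom_memI)
  show "algebra R M" ..
qed (use regular_closed in \<open>(simp; fail) | auto simp: regular_def compose_def
       End_algebra_simps restrict_def fun_eq_iff
       l_distr m_assoc smult_assoc2\<close>)+

text \<open>At b, the commutator of \<open>\<delta>\<close> with multiplication by a is \<delta>(a
  b) - a \<delta>(b). Its equality with \<delta>(a) b is the product rule with one term moved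
  across.\<close>

lemma (in algebra) derivations_iff_lies_over:
  "\<delta> \<in> derivations R M \<longleftrightarrow> lies_over M (End_algebra R M) (regular M) \<delta> \<delta>"
proof -
  have "(\<forall>b\<in>carrier M. \<delta> (a \<otimes>\<^bsub>M\<^esub> b) = a \<otimes>\<^bsub>M\<^esub> \<delta> b \<oplus>\<^bsub>M\<^esub> \<delta> a \<otimes>\<^bsub>M\<^esub> b)
      \<longleftrightarrow> commutator (End_algebra R M) \<delta> (regular M a) = regular M (\<delta> a)"
    if \<delta>: "\<delta> \<in> carrier (End_algebra R M)" and a: "a \<in> carrier M" for a
  proof -
    interpret E: ring "End_algebra R M"
      by (rule End_algebra_ring)
    note \<delta>_closed = End_algebra_memD(1)[OF \<delta>]
    have "commutator (End_algebra R M) \<delta> (regular M a) = regular M (\<delta> a) \<longleftrightarrow>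
        (\<forall>b\<in>carrier M. commutator (End_algebra R M) \<delta> (regular M a) b = regular M (\<delta> a) b)"
      using End_algebra_eqI[OF E.commutator_closed[OF \<delta> regular_closed[OF a]]
          regular_closed[OF \<delta>_closed[OF a]]] by auto
    also have "\<dots> \<longleftrightarrow> (\<forall>b\<in>carrier M. \<delta> (a \<otimes>\<^bsub>M\<^esub> b) \<ominus>\<^bsub>M\<^esub> a \<otimes>\<^bsub>M\<^esub> \<delta> b = \<delta> a \<otimes>\<^bsub>M\<^esub> b)"
      using a \<delta>_closed
      by (simp add: End_algebra_commutator_apply[OF \<delta> regular_closed[OF a]])
        (simp add: regular_def)
    also have "\<dots> \<longleftrightarrow> (\<forall>b\<in>carrier M. \<delta> (a \<otimes>\<^bsub>M\<^esub> b) = a \<otimes>\<^bsub>M\<^esub> \<delta> b \<oplus>\<^bsub>M\<^esub> \<delta> a \<otimes>\<^bsub>M\<^esub> b)"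
      using a \<delta>_closed by (simp add: a_minus_def M.add.inv_solve_right' M.a_comm)
    finally show ?thesis by simp
  qed
  then show ?thesis
    by (auto simp: derivations_def lies_over_def)
qed

section \<open>Closure properties of lying over\<close>

context algebra_under
begin

abbreviation "E \<equiv> End_algebra K A"

sublocale hom: ring_hom_ring A R \<phi>
  by (rule ring_hom_ringI2[OF A.ring_axioms ring_axioms hom])

lemma hom_minus:
  "\<lbrakk>a \<in> carrier A; b \<in> carrier A\<rbrakk> \<Longrightarrow> \<phi> (a \<ominus>\<^bsub>A\<^esub> b) = \<phi> a \<ominus>\<^bsub>R\<^esub> \<phi> b"
  by (simp add: a_minus_def)

lemma hom_commute: "\<lbrakk>a \<in> carrier A; b \<in> carrier A\<rbrakk> \<Longrightarrow> commutator R (\<phi> a) (\<phi> b) = \<zero>\<^bsub>R\<^esub>"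
  by (simp add: commutator_def A.m_comm minus_eq r_neg flip: hom.hom_mult)

lemma lies_over_zero: "lies_over A R \<phi> \<zero>\<^bsub>R\<^esub> \<zero>\<^bsub>E\<^esub>"
  by (simp add: lies_over_def End_algebra_simps commutator_zero_left)

lemma lies_over_add:
  assumes "\<delta> \<in> carrier E" "\<epsilon> \<in> carrier E" "lies_over A R \<phi> r \<delta>" "lies_over A R \<phi> s \<epsilon>"
  shows "lies_over A R \<phi> (r \<oplus>\<^bsub>R\<^esub> s) (\<delta> \<oplus>\<^bsub>E\<^esub> \<epsilon>)"
  using assms by (simp add: lies_over_def End_algebra_simps commutator_add_left End_algebra_memD(1))

lemma lies_over_smult:
  assumes "c \<in> carrier K" "\<delta> \<in> carrier E" "lies_over A R \<phi> r \<delta>"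
  shows "lies_over A R \<phi> (c \<odot>\<^bsub>R\<^esub> r) (c \<odot>\<^bsub>E\<^esub> \<delta>)"
  using assms by (simp add: lies_over_def End_algebra_simps commutator_smult_left
      End_algebra_memD(1) hom_smult)

text \<open>By Jacobi, [[r, s], \<phi> a] = [r, \<phi>(\<epsilon> a)] - [s, \<phi>(\<delta> a)],
  which is \<phi> of \<delta>(\<epsilon> a) - \<epsilon>(\<delta> a).\<close>

lemma lies_over_commutator:
  assumes "\<delta> \<in> carrier E" "\<epsilon> \<in> carrier E" "lies_over A R \<phi> r \<delta>" "lies_over A R \<phi> s \<epsilon>"
  shows "lies_over A R \<phi> (commutator R r s) (commutator E \<delta> \<epsilon>)"
  using assms
  by (simp add: lies_over_def End_algebra_simps commutator_commutator_left
      A.End_algebra_commutator_apply End_algebra_memD(1) hom_minus)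

text \<open>In [\<phi> a r, \<phi> b] = \<phi> a [r, \<phi> b] + [\<phi> a, \<phi> b] r the last
  term vanishes because \<open>A\<close> is commutative.\<close>

lemma lies_over_scale:
  assumes "a \<in> carrier A" "\<delta> \<in> carrier E" "lies_over A R \<phi> r \<delta>"
  shows "lies_over A R \<phi> (\<phi> a \<otimes>\<^bsub>R\<^esub> r) (regular A a \<otimes>\<^bsub>E\<^esub> \<delta>)"
  using assms
  by (simp add: lies_over_def End_algebra_simps commutator_mult_left hom_commute End_algebra_memD(1)
      regular_def compose_def End_algebra_simps)

end

lemma Der_simps:
  "zero (Der K A) = zero (End_algebra K A)"
  "add (Der K A) = add (End_algebra K A)"
  "smult (Der K A) = smult (End_algebra K A)"
  "bracket (Der K A) = commutator (End_algebra K A)"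
  "carrier (Der K A) = derivations K A"
  by (simp_all add: Der_def commutator_lie_def)

lemma der_scale_eq_mult:
  "\<delta> \<in> carrier (End_algebra K A) \<Longrightarrow> der_scale A a \<delta> = regular A a \<otimes>\<^bsub>End_algebra K A\<^esub> \<delta>"
  by (auto simp: der_scale_def regular_def compose_def End_algebra_simps End_algebra_memD(1))



section \<open>The Lie-Rinehart algebra of an algebra under \<open>A\<close>\<close>

context algebra_under
begin

abbreviation "LR \<equiv> LR_of K A R \<phi>"

text \<open>The locale at the regular representation. Below, an unprefixed fact treats the first
  component of a pair and the same fact with prefix \<open>E\<close> the second.\<close>

interpretation E: algebra_under K A E "regular A"
  by (rule A.regular_algebra_under)

lemma LR_carrier:
  "(r, \<delta>) \<in> carrier LR \<longleftrightarrow> lies_over A R \<phi> r \<delta> \<and> lies_over A E (regular A) \<delta> \<delta>"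
  by (auto simp: LR_of_def lies_over_def A.derivations_iff_lies_over)

lemma LR_components:
  "(r, \<delta>) \<in> carrier LR \<Longrightarrow> r \<in> carrier R"
  "(r, \<delta>) \<in> carrier LR \<Longrightarrow> \<delta> \<in> carrier E"
  by (auto simp: LR_carrier dest: lies_over_carrier)

lemma LR_simps:
  "\<zero>\<^bsub>LR\<^esub> = (\<zero>\<^bsub>R\<^esub>, \<zero>\<^bsub>E\<^esub>)"
  "(r, \<delta>) \<oplus>\<^bsub>LR\<^esub> (s, \<epsilon>) = (r \<oplus>\<^bsub>R\<^esub> s, \<delta> \<oplus>\<^bsub>E\<^esub> \<epsilon>)"
  "c \<odot>\<^bsub>LR\<^esub> (r, \<delta>) = (c \<odot>\<^bsub>R\<^esub> r, c \<odot>\<^bsub>E\<^esub> \<delta>)"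
  "bracket LR (r, \<delta>) (s, \<epsilon>) = (commutator R r s, commutator E \<delta> \<epsilon>)"
  "anchor LR (r, \<delta>) = \<delta>"
  by (simp_all add: LR_of_def Der_simps)

lemma LR_act:
  "\<delta> \<in> carrier E \<Longrightarrow> act LR a (r, \<delta>) = (\<phi> a \<otimes>\<^bsub>R\<^esub> r, regular A a \<otimes>\<^bsub>E\<^esub> \<delta>)"
  by (simp add: LR_of_def der_scale_eq_mult[where K = K])

lemma LR_zero_closed: "\<zero>\<^bsub>LR\<^esub> \<in> carrier LR"
  by (simp add: LR_simps LR_carrier lies_over_zero E.lies_over_zero)

lemma LR_add_closed: "\<lbrakk>p \<in> carrier LR; q \<in> carrier LR\<rbrakk> \<Longrightarrow> p \<oplus>\<^bsub>LR\<^esub> q \<in> carrier LR"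
  by (cases p; cases q)
    (auto simp: LR_simps LR_carrier intro: lies_over_add E.lies_over_add lies_over_carrier)

lemma LR_smult_closed: "\<lbrakk>c \<in> carrier K; p \<in> carrier LR\<rbrakk> \<Longrightarrow> c \<odot>\<^bsub>LR\<^esub> p \<in> carrier LR"
  by (cases p)
    (auto simp: LR_simps LR_carrier intro: lies_over_smult E.lies_over_smult lies_over_carrier)

lemma LR_bracket_closed: "\<lbrakk>p \<in> carrier LR; q \<in> carrier LR\<rbrakk> \<Longrightarrow> bracket LR p q \<in> carrier LR"
  by (cases p; cases q)
    (auto simp: LR_simps LR_carrier
      intro: lies_over_commutator E.lies_over_commutator lies_over_carrier)

lemma LR_act_closed: "\<lbrakk>a \<in> carrier A; p \<in> carrier LR\<rbrakk> \<Longrightarrow> act LR a p \<in> carrier LR"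
  by (cases p)
    (auto simp: LR_act LR_components(2), auto simp: LR_carrier
      intro: lies_over_scale E.lies_over_scale lies_over_carrier)

lemma LR_abelian_group: "abelian_group LR"
proof (rule abelian_groupI)
  fix p assume p: "p \<in> carrier LR"
  \<comment> \<open>As for endomorphisms, the negative is the multiple by -1, so closure under
    scalars covers it.\<close>
  then have "(\<ominus>\<^bsub>K\<^esub> \<one>\<^bsub>K\<^esub>) \<odot>\<^bsub>LR\<^esub> p \<oplus>\<^bsub>LR\<^esub> p = \<zero>\<^bsub>LR\<^esub>"
    by (cases p) (simp add: LR_simps LR_components smult_l_minus l_neg E.smult_l_minus E.l_neg)
  moreover have "(\<ominus>\<^bsub>K\<^esub> \<one>\<^bsub>K\<^esub>) \<odot>\<^bsub>LR\<^esub> p \<in> carrier LR"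
    using p by (simp add: LR_smult_closed)
  ultimately show "\<exists>q\<in>carrier LR. q \<oplus>\<^bsub>LR\<^esub> p = \<zero>\<^bsub>LR\<^esub>"
    by blast
qed (clarsimp simp: LR_add_closed LR_zero_closed
      | clarsimp simp: LR_simps LR_components a_ac E.a_ac)+

lemma LR_module: "module K LR"
  by (rule moduleI[OF A.R_cring LR_abelian_group])
    (clarsimp simp: LR_smult_closed
      | clarsimp simp: LR_simps LR_components smult_l_distr E.smult_l_distr smult_r_distr
          E.smult_r_distr smult_assoc1 E.smult_assoc1)+

lemma LR_lie_algebra: "lie_algebra K LR"
  by (rule lie_algebra.intro[OF LR_module], unfold_locales)
    (clarsimp simp: LR_bracket_closed
      | clarsimp simp: LR_simps LR_components commutator_add_left E.commutator_add_left
          commutator_add_right E.commutator_add_right commutator_smult_left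
          E.commutator_smult_left commutator_smult_right E.commutator_smult_right
          commutator_self E.commutator_self commutator_jacobi E.commutator_jacobi)+

text \<open>In both components \<open>act\<close> is left multiplication by the image of a, so the
  module laws are distributivity and associativity in \<open>R\<close> and \<open>E\<close>.\<close>

lemma LR_act_module: "module A (act_module LR)"
proof (rule moduleI[OF A.M_cring])
  show "abelian_group (act_module LR)"
    using LR_abelian_group LR_add_closed LR_zero_closed
    by (intro abelian_groupI) (auto simp: act_module_def intro: abelian_groupE)
next
  fix p assume "p \<in> carrier (act_module LR)"
  then show "\<one>\<^bsub>A\<^esub> \<odot>\<^bsub>act_module LR\<^esub> p = p"
    by (cases p) (simp add: act_module_def LR_act LR_components)
qed (use LR_act_closed in \<open>simp add: act_module_def; fail\<close>
      | auto simp: act_module_def LR_act LR_act_closed LR_simps LR_components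
          l_distr E.l_distr r_distr E.r_distr m_assoc E.m_assoc)+

theorem LR_lie_rinehart: "lie_rinehart K A LR"
proof (intro lie_rinehart.intro LR_lie_algebra LR_act_module lie_rinehart_axioms.intro)
  show "algebra K A" ..
  fix c p assume c: "c \<in> carrier K" and p: "p \<in> carrier LR"
  have "c \<odot>\<^bsub>A\<^esub> \<one>\<^bsub>A\<^esub> \<in> carrier A"
    using c by simp
  then show "act LR (c \<odot>\<^bsub>A\<^esub> \<one>\<^bsub>A\<^esub>) p = c \<odot>\<^bsub>LR\<^esub> p"
    using c p by (cases p) (simp add: LR_act LR_simps LR_components hom_smult E.hom_smult
        smult_mult_left E.smult_mult_left)
next
  show "anchor LR \<in> lie_hom K LR (Der K A)"
    by (auto simp: lie_hom_def linear_maps_def Der_simps LR_simps LR_carrier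
        A.derivations_iff_lies_over)
next
  fix a p assume "a \<in> carrier A" "p \<in> carrier LR"
  then show "anchor LR (act LR a p) = der_scale A a (anchor LR p)"
    by (cases p) (simp add: LR_act LR_simps LR_components der_scale_eq_mult[where K = K])
next
  fix a p q assume a: "a \<in> carrier A" and p: "p \<in> carrier LR" and q: "q \<in> carrier LR"
  obtain r \<delta> s \<epsilon> where pq: "p = (r, \<delta>)" "q = (s, \<epsilon>)"
    by (cases p; cases q) blast
  \<comment> \<open>Bracketing p with a multiple of q produces the extra terms [r, \<phi> a] s and
    [\<delta>, \<open>regular A a\<close>] \<epsilon>. Since p lies in \<open>LR\<close>, these are
    the action of \<delta> a on q.\<close>
  have "commutator R r (\<phi> a) = \<phi> (\<delta> a)" "commutator E \<delta> (regular A a) = regular A (\<delta> a)"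
    using a p by (simp_all add: pq LR_carrier lies_over_def)
  then show "bracket LR p (act LR a q)
      = act LR a (bracket LR p q) \<oplus>\<^bsub>LR\<^esub> act LR (anchor LR p a) q"
    using a p q by (simp add: pq LR_act LR_simps LR_components commutator_mult_right
        E.commutator_mult_right)
qed

text \<open>All demands on the second component are axioms for the anchor of \<open>L\<close>, and
  compatibility with anchors holds by construction. What remains concerns \<open>\<rho>\<close>;
  lying over the anchor expresses that the pairs belong to \<open>LR\<close>.\<close>

theorem LR_morphism_iff:
  fixes L (structure)
  assumes L: "lie_rinehart K A L"
  shows "lie_rinehart_morphism K A L LR (\<lambda>X\<in>carrier L. (\<rho> X, anchor L X)) \<longleftrightarrow>
    \<rho> \<in> lie_hom K L (commutator_lie R) \<and>
    (\<forall>X\<in>carrier L. lies_over A R \<phi> (\<rho> X) (anchor L X)) \<and>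
    (\<forall>a\<in>carrier A. \<forall>X\<in>carrier L. \<rho> (act L a X) = \<phi> a \<otimes>\<^bsub>R\<^esub> \<rho> X)"
proof -
  interpret L: lie_rinehart K A L
    by (rule L)
  have act_closed: "act L a X \<in> carrier L" if "a \<in> carrier A" "X \<in> carrier L" for a X
    using L.AL.smult_closed[of a X] that by (simp add: act_module_def)
  have anchor_hom: "anchor L \<in> lie_hom K L (Der K A)"
    by (rule L.anchor_lie_hom)
  have anchor_der: "lies_over A E (regular A) (anchor L X) (anchor L X)" if "X \<in> carrier L" for X
    using anchor_hom that
    by (auto simp: lie_hom_def linear_maps_def Der_simps A.derivations_iff_lies_over)
  show ?thesis
    using L LR_lie_rinehart anchor_hom
    by (auto simp: lie_rinehart_morphism_def lie_hom_def linear_maps_def Pi_iff commutator_lie_def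
        LR_simps LR_carrier LR_act Der_simps act_closed anchor_der L.L.bracket_closed
        lies_over_carrier L.anchor_act der_scale_eq_mult[where K = K]
        lies_over_carrier[OF anchor_der])
qed

end


section \<open>Endomorphisms of a module\<close>

lemma restrict_scalars_module:
  assumes "algebra K A" and "module A M"
  shows "module K (restrict_scalars A M)"
proof -
  interpret A: algebra K A by fact
  interpret M: module A M by fact
  \<comment> \<open>The scalars act on \<open>M\<close> through their images in \<open>A\<close>;
    associativity of the action needs this passage to be multiplicative.\<close>
  have scalar_mult:
    "(c \<otimes>\<^bsub>K\<^esub> d) \<odot>\<^bsub>A\<^esub> \<one>\<^bsub>A\<^esub> = (c \<odot>\<^bsub>A\<^esub> \<one>\<^bsub>A\<^esub>) \<otimes>\<^bsub>A\<^esub> (d \<odot>\<^bsub>A\<^esub> \<one>\<^bsub>A\<^esub>)"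
    if "c \<in> carrier K" "d \<in> carrier K" for c d
    using that by (simp add: A.smult_assoc1 A.smult_assoc2)
  show ?thesis
    by (rule moduleI[OF A.R_cring abelian_groupI])
      (use abelian_groupE(6)[OF M.abelian_group_axioms] in
        \<open>auto simp: restrict_scalars_def M.M.a_ac A.smult_l_distr M.smult_l_distr
        M.smult_r_distr scalar_mult M.smult_assoc1\<close>)
qed

text \<open>Scalars act through elements of the commutative algebra \<open>A\<close>, so
  multiplication by a commutes with them.\<close>

lemma left_mult_closed:
  assumes "algebra K A" and "module A M" and a: "a \<in> carrier A"
  shows "left_mult M a \<in> carrier (End_module K A M)"
proof -
  interpret A: algebra K A by fact
  interpret M: module A M by fact
  show ?thesis
    unfolding End_module_def
    by (rule End_algebra_memI)
      (use a in \<open>simp_all add: restrict_scalars_def left_mult_def M.smult_r_distr A.m_comm[of a]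
        flip: M.smult_assoc1\<close>)
qed

lemma End_module_algebra_under:
  assumes A: "algebra K A" and M: "module A M"
  shows "algebra_under K A (End_module K A M) (left_mult M)"
proof -
  interpret A: algebra K A by fact
  interpret M: module A M by fact
  show ?thesis
  proof (intro algebra_under.intro algebra_under_axioms.intro ring_hom_memI A)
    show "assoc_algebra K (End_module K A M)"
      unfolding End_module_def
      by (rule module.End_algebra_assoc_algebra[OF restrict_scalars_module[OF A M]])
  next
    fix c a assume "c \<in> carrier K" "a \<in> carrier A"
    then have "(c \<odot>\<^bsub>A\<^esub> a) \<odot>\<^bsub>M\<^esub> m = (c \<odot>\<^bsub>A\<^esub> \<one>\<^bsub>A\<^esub>) \<odot>\<^bsub>M\<^esub> (a \<odot>\<^bsub>M\<^esub> m)"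
      if "m \<in> carrier M" for m
      using that by (simp add: A.smult_assoc2 flip: M.smult_assoc1)
    then show "left_mult M (c \<odot>\<^bsub>A\<^esub> a) = c \<odot>\<^bsub>End_module K A M\<^esub> left_mult M a"
      by (auto simp: End_module_def End_algebra_simps restrict_scalars_def left_mult_def
          restrict_def)
  qed (use left_mult_closed[OF A M] in \<open>(simp; fail) |
        auto simp: End_module_def End_algebra_simps restrict_scalars_def left_mult_def compose_def
          restrict_def fun_eq_iff M.smult_l_distr M.smult_assoc1\<close>)+
qed

lemma lie_rinehart_module_iff:
  assumes A: "algebra K A" and L: "lie_rinehart K A L" and M: "module A M"
  shows "lie_rinehart_module K A L M \<rho> \<longleftrightarrow>
    lie_rinehart_morphism K A L (LR_of K A (End_module K A M) (left_mult M))
      (\<lambda>X\<in>carrier L. (\<rho> X, anchor L X))"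
proof -
  interpret A: algebra K A by fact
  interpret M: module A M by fact
  interpret L: lie_rinehart K A L by fact
  interpret R: algebra_under K A "End_module K A M" "left_mult M"
    by (rule End_module_algebra_under[OF A M])
  let ?R = "End_module K A M" and ?\<phi> = "left_mult M"
  have carrier: "carrier (restrict_scalars A M) = carrier M"
    by (simp add: restrict_scalars_def)
  have eq_iff: "f = g \<longleftrightarrow> (\<forall>m\<in>carrier M. f m = g m)" if "f \<in> carrier ?R" "g \<in> carrier ?R" for f g
    using that End_algebra_eqI[of f K "restrict_scalars A M" g]
    by (auto simp: End_module_def carrier)
  have act_closed: "act L a X \<in> carrier L" if "a \<in> carrier A" "X \<in> carrier L" for a X
    using L.AL.smult_closed[of a X] that by (simp add: act_module_def)
  have anchor_closed: "anchor L X a \<in> carrier A" if "a \<in> carrier A" "X \<in> carrier L" for a X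
    using L.anchor_lie_hom that
    by (auto simp: lie_hom_def linear_maps_def Der_simps derivations_def dest: End_algebra_memD(1))
  \<comment> \<open>The conditions of a module hold at each m, those of
    \<open>LR_morphism_iff\<close> between endomorphisms. They can be exchanged by
    \<open>eq_iff\<close> once the values of \<open>\<rho>\<close> are endomorphisms, hence the
    assumption that \<open>\<rho>\<close> is a Lie morphism.\<close>
  have "(\<forall>a\<in>carrier A. \<forall>X\<in>carrier L. \<forall>m\<in>carrier M. \<rho> (act L a X) m = a \<odot>\<^bsub>M\<^esub> \<rho> X m) \<longleftrightarrow>
      (\<forall>a\<in>carrier A. \<forall>X\<in>carrier L. \<rho> (act L a X) = ?\<phi> a \<otimes>\<^bsub>?R\<^esub> \<rho> X)"
    and "(\<forall>X\<in>carrier L. \<forall>m\<in>carrier M. \<forall>a\<in>carrier A.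
        \<rho> X (a \<odot>\<^bsub>M\<^esub> m) = a \<odot>\<^bsub>M\<^esub> \<rho> X m \<oplus>\<^bsub>M\<^esub> anchor L X a \<odot>\<^bsub>M\<^esub> m) \<longleftrightarrow>
      (\<forall>X\<in>carrier L. lies_over A ?R ?\<phi> (\<rho> X) (anchor L X))"
    if "\<rho> \<in> lie_hom K L (commutator_lie ?R)"
  proof -
    have closed: "\<rho> X \<in> carrier ?R" if "X \<in> carrier L" for X
      using that \<open>\<rho> \<in> _\<close> by (auto simp: lie_hom_def linear_maps_def commutator_lie_def)
    have closed_apply: "\<rho> X m \<in> carrier M" if "X \<in> carrier L" "m \<in> carrier M" for X m
      using that closed[of X] End_algebra_memD(1)[of "\<rho> X" K "restrict_scalars A M" m]
      by (simp add: End_module_def carrier)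
    have mult_apply: "(?\<phi> a \<otimes>\<^bsub>?R\<^esub> \<rho> X) m = a \<odot>\<^bsub>M\<^esub> \<rho> X m"
      if "a \<in> carrier A" "X \<in> carrier L" "m \<in> carrier M" for a X m
      using that by (simp add: End_module_def End_algebra_simps carrier compose_def left_mult_def
          closed_apply)
    show "(\<forall>a\<in>carrier A. \<forall>X\<in>carrier L. \<forall>m\<in>carrier M. \<rho> (act L a X) m = a \<odot>\<^bsub>M\<^esub> \<rho> X m) \<longleftrightarrow>
        (\<forall>a\<in>carrier A. \<forall>X\<in>carrier L. \<rho> (act L a X) = ?\<phi> a \<otimes>\<^bsub>?R\<^esub> \<rho> X)"
      by (simp add: eq_iff closed act_closed mult_apply)
    have commutator_apply: "commutator ?R (\<rho> X) (?\<phi> a) m = \<rho> X (a \<odot>\<^bsub>M\<^esub> m) \<ominus>\<^bsub>M\<^esub> a \<odot>\<^bsub>M\<^esub> \<rho> X m"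
      if "a \<in> carrier A" "X \<in> carrier L" "m \<in> carrier M" for a X m
    proof -
      \<comment> \<open>Subtraction is built from the carrier, zero and addition alone, and
        restricting scalars keeps all three.\<close>
      have "x \<ominus>\<^bsub>restrict_scalars A M\<^esub> y = x \<ominus>\<^bsub>M\<^esub> y" for x y
        by (simp add: restrict_scalars_def a_minus_def a_inv_def m_inv_def)
      then show ?thesis
        using that closed[of X] R.hom.hom_closed[of a]
          module.End_algebra_commutator_apply[OF restrict_scalars_module[OF A M], of "\<rho> X" "?\<phi> a" m]
        by (simp add: End_module_def carrier left_mult_def closed_apply)
    qed
    \<comment> \<open>Moving the subtracted term a \<rho>(X)(m) across turns lying over the anchor
      into the Leibniz rule.\<close>
    have "commutator ?R (\<rho> X) (?\<phi> a) = ?\<phi> (anchor L X a) \<longleftrightarrow>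
        (\<forall>m\<in>carrier M. \<rho> X (a \<odot>\<^bsub>M\<^esub> m) = a \<odot>\<^bsub>M\<^esub> \<rho> X m \<oplus>\<^bsub>M\<^esub> anchor L X a \<odot>\<^bsub>M\<^esub> m)"
      if "a \<in> carrier A" "X \<in> carrier L" for a X
      using that by (simp add: eq_iff closed anchor_closed commutator_apply)
        (simp add: left_mult_def a_minus_def M.M.add.inv_solve_right' closed_apply anchor_closed
          M.M.a_comm)
    then show "(\<forall>X\<in>carrier L. \<forall>m\<in>carrier M. \<forall>a\<in>carrier A.
        \<rho> X (a \<odot>\<^bsub>M\<^esub> m) = a \<odot>\<^bsub>M\<^esub> \<rho> X m \<oplus>\<^bsub>M\<^esub> anchor L X a \<odot>\<^bsub>M\<^esub> m) \<longleftrightarrow>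
      (\<forall>X\<in>carrier L. lies_over A ?R ?\<phi> (\<rho> X) (anchor L X))"
      by (auto simp: lies_over_def closed)
  qed
  then show ?thesis
    unfolding R.LR_morphism_iff[OF L] lie_rinehart_module_def by blast
qed

section \<open>The bijection between module structures and morphisms\<close>

theorem proposition4p5:
  fixes K :: "('k, 'x) ring_scheme"
    and A :: "('k, 'a, 'y) module_scheme"
    and L :: "('k, 'a, 'l, 'z) lie_rinehart_scheme"
    and M :: "('a, 'm, 'w) module_scheme"
  assumes "field K" and "char_zero K"
    and "algebra K A"
    and "lie_rinehart K A L"
    and "module A M"
  shows "bij_betw (\<lambda>\<rho>. \<lambda>X\<in>carrier L. (\<rho> X, anchor L X))
    {\<rho> \<in> extensional (carrier L). lie_rinehart_module K A L M \<rho>}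
    {f \<in> extensional (carrier L).
       lie_rinehart_morphism K A L (LR_of K A (End_module K A M) (left_mult M)) f}"
    (is "bij_betw ?pair ?modules ?morphisms")
proof (rule bij_betw_byWitness[where f' = "\<lambda>f. \<lambda>X\<in>carrier L. fst (f X)"])
  note module_iff = lie_rinehart_module_iff[OF assms(3-5)]
  \<comment> \<open>The anchor of the target is \<open>snd\<close>, and a morphism preserves
    anchors, so the second component of f X is forced to be the anchor of X. Extensionality settles
    the values outside \<open>L\<close>.\<close>
  have section_of: "?pair (\<lambda>X\<in>carrier L. fst (f X)) = f" if "f \<in> ?morphisms" for f
    using that
    by (auto simp: lie_rinehart_morphism_def LR_of_def prod_eq_iff
        intro!: extensionalityI[of _ "carrier L"])
  then show "\<forall>f\<in>?morphisms. ?pair (\<lambda>X\<in>carrier L. fst (f X)) = f"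
    by blast
  show "\<forall>\<rho>\<in>?modules. (\<lambda>X\<in>carrier L. fst (?pair \<rho> X)) = \<rho>"
    by (auto intro!: extensionalityI[of _ "carrier L"])
  show "?pair ` ?modules \<subseteq> ?morphisms"
    by (auto simp: module_iff)
  \<comment> \<open>By \<open>section_of\<close> the first components of f pair up to f again, a
    morphism; \<open>module_iff\<close> then makes them a module structure.\<close>
  show "(\<lambda>f. \<lambda>X\<in>carrier L. fst (f X)) ` ?morphisms \<subseteq> ?modules"
    using section_of by (simp add: image_subset_iff module_iff)
qed

end
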